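(* Let $k, r\geq 2$ be integers. There exist constants $C, c>0$ (depending only on $k$ and $r$) such that if $G$ is an $n$-vertex linear $r$-graph with $\mathrm{e}(G)\geq Cn^{1+1/k}$, then $G$ contains at least $c\left(\frac{\mathrm{e}(G)}{n}\right)^{2k}$ copies of $C^{(r)}_{2k}$.
   Context: An $r$-graph is an $r$-uniform hypergraph; $\mathrm{e}(G)$ denotes its number of edges. An $r$-graph is linear if any two distinct edges share at most one vertex. The $r$-uniform linear cycle $C^{(r)}_{m}$ of length $m$ is obtained from a $2$-uniform cycle $v_1v_2\dots v_mv_1$ by extending each edge $v_iv_{i+1}$ (indices mod $m$) to the $r$-set $\{v_i,v_{i+1}\}\cup I_i$, where $I_1,\dots,I_m$ are pairwise disjoint $(r-2)$-sets of new vertices. A copy of $H$ in $G$ is a subgraph of $G$ isomorphic to $H$. *)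

theory Defs
  imports Complex_Main
begin

record 'a hypergraph =
  verts :: "'a set"
  edges :: "'a set set"

definition hypergraph :: "'a hypergraph \<Rightarrow> bool" where
  "hypergraph G \<longleftrightarrow> finite (verts G) \<and> (\<forall>e\<in>edges G. e \<subseteq> verts G)"

definition r_graph :: "nat \<Rightarrow> 'a hypergraph \<Rightarrow> bool" where
  "r_graph r G \<longleftrightarrow> hypergraph G \<and> (\<forall>e\<in>edges G. card e = r)"

definition linear_hypergraph :: "'a hypergraph \<Rightarrow> bool" where
  "linear_hypergraph G \<longleftrightarrow> (\<forall>e\<in>edges G. \<forall>f\<in>edges G. e \<noteq> f \<longrightarrow> card (e \<inter> f) \<le> 1)"

definition subhypergraph :: "'a hypergraph \<Rightarrow> 'a hypergraph \<Rightarrow> bool" where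
  "subhypergraph H G \<longleftrightarrow> hypergraph H \<and> verts H \<subseteq> verts G \<and> edges H \<subseteq> edges G"

definition isomorphic :: "'a hypergraph \<Rightarrow> 'b hypergraph \<Rightarrow> bool" where
  "isomorphic G H \<longleftrightarrow>
    (\<exists>f. bij_betw f (verts G) (verts H) \<and> (\<lambda>e. f ` e) ` edges G = edges H)"

definition copies :: "'b hypergraph \<Rightarrow> 'a hypergraph \<Rightarrow> 'a hypergraph set" where
  "copies H G = {K. subhypergraph K G \<and> isomorphic K H}"

text \<open>
  Indices run over \<open>0, \<dots>, m - 1\<close> instead of \<open>1, \<dots>, m\<close>. The pair \<open>(i, 0)\<close> is the vertex
  \<open>v\<^sub>i\<close> of the underlying 2-uniform cycle, and \<open>{i} \<times> {1..<r - 1}\<close> is the \<open>(r - 2)\<close>-set \<open>I\<^sub>i\<close>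
  of new vertices. Meaningful for \<open>r \<ge> 2\<close> and \<open>m \<ge> 3\<close>.
\<close>

definition linear_cycle :: "nat \<Rightarrow> nat \<Rightarrow> (nat \<times> nat) hypergraph" where
  "linear_cycle r m =
    \<lparr>verts = {..<m} \<times> {..<r - 1},
     edges = (\<lambda>i. {(i, 0), (Suc i mod m, 0)} \<union> {i} \<times> {1..<r - 1}) ` {..<m}\<rparr>"

end

theory Submission
  imports Defs "HOL-Analysis.Convex"
begin

text \<open>
  Delete vertices of small degree until every vertex lies in at least \<open>t = e(G)/n\<close> edges, and give an
  edge \<open>xy\<close> of the 2-shadow the weight \<open>1 / sqrt (deg x * deg y)\<close>, where degrees are taken in the
  shadow. Let \<open>h\<^sub>j\<close> be the total weight of closed walks of length \<open>2j\<close>. The vector \<open>sqrt (deg x)\<close> is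
  fixed by the weight matrix, so \<open>h\<^sub>j \<ge> 1\<close>; as \<open>h\<close> is log-convex with \<open>h\<^sub>0 \<le> n\<close>, this gives
  \<open>h\<^sub>k\<^sub>-\<^sub>1 \<le> n\<^bsup>1/k\<^esup> h\<^sub>k\<close>. A closed walk of length \<open>2k\<close> that does not trace a linear cycle has, after a
  rotation, a vertex that is restricted to boundedly many neighbours of the next one by the \<open>k\<close> steps
  that follow. By Cauchy--Schwarz the total weight of these walks is at most a constant times
  \<open>sqrt (h\<^sub>k h\<^sub>k\<^sub>-\<^sub>1 / t)\<close>, hence at most \<open>h\<^sub>k / 2\<close> once \<open>t \<ge> C n\<^bsup>1/k\<^esup>\<close>. Each closed walk weighs at most
  \<open>t\<^bsup>-2k\<^esup>\<close>, so at least \<open>t\<^bsup>2k\<^esup> / 2\<close> of them trace linear cycles. Weighting by degrees is what makes a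
  reduction to almost regular host graphs unnecessary.
\<close>

section \<open>Weighted closed walks\<close>

fun path_weight :: "('a \<Rightarrow> 'a \<Rightarrow> real) \<Rightarrow> 'a list \<Rightarrow> real" where
  "path_weight N (x # y # xs) = N x y * path_weight N (y # xs)"
| "path_weight N _ = 1"

text \<open>The start is not repeated in the list, so \<open>rotate\<close> moves the base point of
  a closed walk; appending \<open>hd xs\<close> restores the closing step.\<close>

definition cycle_weight :: "('a \<Rightarrow> 'a \<Rightarrow> real) \<Rightarrow> 'a list \<Rightarrow> real" where
  "cycle_weight N xs = path_weight N (xs @ [hd xs])"

lemma path_weight_append:
  "xs \<noteq> [] \<Longrightarrow> path_weight N (xs @ ys) = path_weight N xs * path_weight N (last xs # ys)"
  by (induction N xs rule: path_weight.induct) auto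

lemma path_weight_nonneg: "(\<And>x y. 0 \<le> N x y) \<Longrightarrow> 0 \<le> path_weight N xs"
  by (induction N xs rule: path_weight.induct) auto

lemma path_weight_le_power:
  assumes "\<And>x y. 0 \<le> N x y" "\<And>x y. N x y \<le> q"
  shows "path_weight N xs \<le> q ^ (length xs - 1)"
  using assms
proof (induction N xs rule: path_weight.induct)
  case (1 N x y xs)
  have "0 \<le> q" using 1(2,3) order_trans by blast
  then show ?case
    using 1 path_weight_nonneg[of N "y # xs"] by (auto intro!: mult_mono)
qed auto

lemma path_weight_nonzeroD:
  "path_weight N xs \<noteq> 0 \<Longrightarrow> Suc i < length xs \<Longrightarrow> N (xs ! i) (xs ! Suc i) \<noteq> 0"
  by (induction N xs arbitrary: i rule: path_weight.induct) (auto simp: nth_Cons split: nat.splits)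

lemma cycle_weight_nonzeroD:
  assumes "cycle_weight N xs \<noteq> 0" "i < length xs"
  shows "N (xs ! i) (xs ! (Suc i mod length xs)) \<noteq> 0"
proof -
  have "(xs @ [hd xs]) ! Suc i = xs ! (Suc i mod length xs)"
  proof (cases "Suc i = length xs")
    case True
    then show ?thesis using assms(2) by (cases xs) (simp_all add: nth_append)
  next
    case False
    then show ?thesis using assms(2) by (simp add: nth_append)
  qed
  then show ?thesis
    using path_weight_nonzeroD[of N "xs @ [hd xs]" i] assms
    by (simp add: cycle_weight_def nth_append)
qed

lemma cycle_weight_rotate1: "cycle_weight N (rotate1 xs) = cycle_weight N xs"
proof (cases xs)
  case Nil
  then show ?thesis by simp
next
  case (Cons x ys)
  then show ?thesis
    using path_weight_append[of "ys @ [x]" N "[hd (ys @ [x])]"]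
    by (cases ys) (auto simp: cycle_weight_def)
qed

lemma cycle_weight_rotate: "cycle_weight N (rotate n xs) = cycle_weight N xs"
  by (induction n) (auto simp: cycle_weight_rotate1)

section \<open>Sums over lists of fixed length\<close>

lemma sum_lists_Suc:
  fixes f :: "'a list \<Rightarrow> real"
  assumes "finite V"
  shows "(\<Sum>xs | set xs \<subseteq> V \<and> length xs = Suc n. f xs) =
    (\<Sum>x\<in>V. \<Sum>xs | set xs \<subseteq> V \<and> length xs = n. f (x # xs))"
proof -
  have "(\<Sum>xs | set xs \<subseteq> V \<and> length xs = Suc n. f xs) =
      (\<Sum>(x, xs) \<in> V \<times> {xs. set xs \<subseteq> V \<and> length xs = n}. f (x # xs))"
    by (rule sum.reindex_bij_witness[of _ "\<lambda>(x, xs). x # xs" "\<lambda>xs. (hd xs, tl xs)"])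
      (auto simp: length_Suc_conv)
  then show ?thesis by (simp add: sum.cartesian_product)
qed

lemma sum_lists_append:
  fixes f :: "'a list \<Rightarrow> real"
  shows "(\<Sum>xs | set xs \<subseteq> V \<and> length xs = a + b. f xs) =
    (\<Sum>ys | set ys \<subseteq> V \<and> length ys = a. \<Sum>zs | set zs \<subseteq> V \<and> length zs = b. f (ys @ zs))"
proof -
  have "(\<Sum>xs | set xs \<subseteq> V \<and> length xs = a + b. f xs) =
      (\<Sum>(ys, zs) \<in> {ys. set ys \<subseteq> V \<and> length ys = a} \<times> {zs. set zs \<subseteq> V \<and> length zs = b}.
        f (ys @ zs))"
    by (rule sum.reindex_bij_witness[of _ "\<lambda>(ys, zs). ys @ zs" "\<lambda>xs. (take a xs, drop a xs)"])
      (auto dest: in_set_takeD in_set_dropD)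
  then show ?thesis by (simp add: sum.cartesian_product)
qed

lemma sum_lists_rotate:
  fixes f :: "'a list \<Rightarrow> real"
  assumes "finite V"
  shows "(\<Sum>xs | set xs \<subseteq> V \<and> length xs = m. f (rotate n xs)) =
    (\<Sum>xs | set xs \<subseteq> V \<and> length xs = m. f xs)"
proof (rule sum.reindex_bij_betw)
  let ?A = "{xs. set xs \<subseteq> V \<and> length xs = m}"
  have "inj (rotate n :: 'a list \<Rightarrow> _)"
    by (induction n) (simp_all add: rotate_def inj_compose[unfolded comp_def] inj_rotate1)
  then have inj: "inj_on (rotate n) ?A" by (rule inj_on_subset) simp
  moreover have "rotate n ` ?A = ?A"
    by (rule endo_inj_surj[OF _ _ inj]) (auto simp: finite_lists_length_eq assms)
  ultimately show "bij_betw (rotate n) ?A ?A" by (simp add: bij_betw_def)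
qed

section \<open>Powers of a symmetric weight matrix and their even traces\<close>

locale weighted_graph =
  fixes V :: "'a set" and N :: "'a \<Rightarrow> 'a \<Rightarrow> real"
  assumes finite_V: "finite V"
    and N_sym: "N x y = N y x"
    and N_nonneg: "0 \<le> N x y"
begin

text \<open>These are the entries of the \<open>j\<close>-th power of the matrix \<open>N\<close> on
  \<open>V\<close>.\<close>

primrec walks :: "nat \<Rightarrow> 'a \<Rightarrow> 'a \<Rightarrow> real" where
  "walks 0 u v = of_bool (u = v)"
| "walks (Suc j) u v = (\<Sum>w\<in>V. N u w * walks j w v)"

text \<open>The squared Frobenius norm of the \<open>j\<close>-th power of \<open>N\<close>. By
  symmetry it is the trace of the power \<open>2 * j\<close>, the quantity \<open>h\<^sub>j\<close>
  of the overview.\<close>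

definition moment :: "nat \<Rightarrow> real" where
  "moment j = (\<Sum>u\<in>V. \<Sum>v\<in>V. (walks j u v)\<^sup>2)"

lemma walks_nonneg: "0 \<le> walks j u v"
  by (induction j arbitrary: u) (auto intro!: sum_nonneg mult_nonneg_nonneg N_nonneg)

lemma walks_add: "u \<in> V \<Longrightarrow> walks (i + j) u v = (\<Sum>w\<in>V. walks i u w * walks j w v)"
proof (induction i arbitrary: u)
  case 0
  then show ?case using finite_V by (simp add: of_bool_def if_distrib[of "\<lambda>x. x * _"] cong: if_cong)
next
  case (Suc i)
  have "walks (Suc i + j) u v = (\<Sum>x\<in>V. \<Sum>w\<in>V. N u x * (walks i x w * walks j w v))"
    by (simp add: Suc.IH sum_distrib_left)
  also have "\<dots> = (\<Sum>w\<in>V. \<Sum>x\<in>V. N u x * (walks i x w * walks j w v))"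
    by (rule sum.swap)
  finally show ?case by (simp add: sum_distrib_right mult.assoc)
qed

lemma walks_1: "v \<in> V \<Longrightarrow> walks (Suc 0) u v = N u v"
  using finite_V by (simp add: of_bool_def if_distrib[of "\<lambda>x. _ * x"] cong: if_cong)

lemma walks_sym: "u \<in> V \<Longrightarrow> v \<in> V \<Longrightarrow> walks j u v = walks j v u"
proof (induction j arbitrary: u)
  case 0
  then show ?case by auto
next
  case (Suc j)
  have "walks (Suc j) u v = (\<Sum>w\<in>V. walks j v w * walks (Suc 0) w u)"
    using Suc walks_1[OF Suc.prems(1)]
    by (simp add: N_sym[of u] mult.commute del: walks.simps(2)) (simp add: N_sym[of u] mult.commute)
  also have "\<dots> = walks (j + Suc 0) v u" by (rule walks_add[OF Suc.prems(2), symmetric])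
  finally show ?case by simp
qed

lemma walks_Suc_right:
  "u \<in> V \<Longrightarrow> v \<in> V \<Longrightarrow> walks (Suc j) u v = (\<Sum>w\<in>V. walks j u w * N w v)"
  using walks_add[of u j "Suc 0" v] walks_1[of v] by simp

lemma walks_trace:
  "(\<Sum>u\<in>V. \<Sum>v\<in>V. walks i u v * walks j u v) = (\<Sum>u\<in>V. walks (i + j) u u)"
  by (intro sum.cong refl) (auto simp: walks_add walks_sym intro!: sum.cong)

text \<open>The trace of the power \<open>2 * j + 2\<close> is the entrywise inner product of the
  powers \<open>j\<close> and \<open>j + 2\<close>, to which Cauchy-Schwarz applies.\<close>

lemma moment_log_convex: "(moment (Suc j))\<^sup>2 \<le> moment j * moment (Suc (Suc j))"
proof -
  have "moment (Suc j) = (\<Sum>u\<in>V. \<Sum>v\<in>V. walks j u v * walks (Suc (Suc j)) u v)"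
    unfolding moment_def power2_eq_square walks_trace by simp
  also have "\<dots> = (\<Sum>p\<in>V \<times> V. walks j (fst p) (snd p) * walks (Suc (Suc j)) (fst p) (snd p))"
    by (simp add: sum.cartesian_product split_def del: walks.simps)
  finally have eq: "moment (Suc j) = \<dots>" .
  have "(moment (Suc j))\<^sup>2 \<le>
      (\<Sum>p\<in>V \<times> V. (walks j (fst p) (snd p))\<^sup>2) *
      (\<Sum>p\<in>V \<times> V. (walks (Suc (Suc j)) (fst p) (snd p))\<^sup>2)"
    unfolding eq by (rule Cauchy_Schwarz_ineq_sum)
  then show ?thesis
    by (simp add: moment_def sum.cartesian_product split_def del: walks.simps)
qed

lemma moment_0: "moment 0 = card V"
  using finite_V by (simp add: moment_def of_bool_def if_distrib[of "\<lambda>x. x\<^sup>2"] cong: if_cong)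

text \<open>Since \<open>p\<close> is fixed by \<open>N\<close>, the quadratic form of every power
  at \<open>p\<close> equals the squared norm of \<open>p\<close>. Cauchy-Schwarz compares the power
  with the rank-one matrix \<open>p u * p v\<close>, whose Frobenius norm is that same
  number.\<close>

lemma moment_ge_1:
  assumes eig: "\<And>u. u \<in> V \<Longrightarrow> (\<Sum>w\<in>V. N u w * p w) = p u"
    and pos: "(\<Sum>u\<in>V. (p u)\<^sup>2) > 0"
  shows "1 \<le> moment j"
proof -
  let ?S = "\<Sum>u\<in>V. (p u)\<^sup>2"
  have walk: "(\<Sum>w\<in>V. walks j u w * p w) = p u" if "u \<in> V" for u
    using that
  proof (induction j arbitrary: u)
    case 0
    then show ?case
      using finite_V by (simp add: of_bool_def if_distrib[of "\<lambda>x. x * _"] cong: if_cong)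
  next
    case (Suc j)
    have "(\<Sum>w\<in>V. walks (Suc j) u w * p w) = (\<Sum>w\<in>V. \<Sum>x\<in>V. N u x * (walks j x w * p w))"
      by (simp add: sum_distrib_right mult.assoc)
    also have "\<dots> = (\<Sum>x\<in>V. N u x * (\<Sum>w\<in>V. walks j x w * p w))"
      unfolding sum_distrib_left by (rule sum.swap)
    finally show ?case using Suc by (simp add: eig)
  qed
  have "?S = (\<Sum>u\<in>V. p u * (\<Sum>v\<in>V. walks j u v * p v))"
    by (simp add: walk power2_eq_square)
  also have "\<dots> = (\<Sum>z\<in>V \<times> V. walks j (fst z) (snd z) * (p (fst z) * p (snd z)))"
    by (simp add: sum_distrib_left sum.cartesian_product split_def mult_ac)
  finally have eq: "?S = \<dots>" .
  have "?S\<^sup>2 \<le> (\<Sum>z\<in>V \<times> V. (walks j (fst z) (snd z))\<^sup>2) *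
      (\<Sum>z\<in>V \<times> V. (p (fst z) * p (snd z))\<^sup>2)"
    by (subst eq) (rule Cauchy_Schwarz_ineq_sum)
  also have "\<dots> = moment j * ?S\<^sup>2"
    by (simp add: moment_def sum.cartesian_product split_def power_mult_distrib
        power2_eq_square[of ?S] sum_product)
  finally show ?thesis using pos by simp
qed

text \<open>Log-convexity makes the quotients of consecutive moments increase, so the quotient
  \<open>\<rho>\<close> at \<open>k\<close> bounds all earlier ones. Climbing from
  \<open>moment 0 = card V\<close> to \<open>moment (Suc k)\<close>, which is at least 1, bounds
  \<open>\<rho>\<close> from below.\<close>

lemma moment_le_root:
  assumes ge1: "\<And>j. 1 \<le> moment j"
  shows "moment k \<le> root (Suc k) (card V) * moment (Suc k)"
proof -
  define \<rho> where "\<rho> = moment (Suc k) / moment k"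
  have pos: "0 < moment j" for j using ge1[of j] by linarith
  have step: "moment (Suc j) / moment j \<le> moment (Suc (Suc j)) / moment (Suc j)" for j
    using moment_log_convex[of j] pos[of j] pos[of "Suc j"]
    by (simp add: field_simps power2_eq_square)
  have "incseq (\<lambda>j. moment (Suc j) / moment j)" by (rule incseq_SucI) (rule step)
  then have ratio: "moment (Suc j) \<le> \<rho> * moment j" if "j \<le> k" for j
    unfolding \<rho>_def using incseqD[OF \<open>incseq _\<close> that] pos[of j] by (simp only: pos_divide_le_eq)
  have \<rho>: "0 < \<rho>" unfolding \<rho>_def using pos by simp
  have "moment j \<le> \<rho> ^ j * card V" if "j \<le> Suc k" for j
    using that
  proof (induction j)
    case (Suc j)
    have "moment (Suc j) \<le> \<rho> * moment j" using Suc ratio by simp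
    also have "\<dots> \<le> \<rho> * (\<rho> ^ j * card V)" using Suc \<rho> by simp
    finally show ?case by simp
  qed (simp add: moment_0)
  from this[of "Suc k"] have "1 \<le> \<rho> ^ Suc k * card V" using ge1[of "Suc k"] by simp
  then have "1 \<le> root (Suc k) (\<rho> ^ Suc k * card V)" by (simp del: power_Suc)
  also have "\<dots> = \<rho> * root (Suc k) (card V)"
    using \<rho> by (simp add: real_root_mult real_root_power_cancel del: power_Suc)
  finally show ?thesis
    using pos[of k] unfolding \<rho>_def by (simp add: field_simps)
qed

section \<open>Closed walks expressed by matrix powers\<close>

lemma sum_path_weight_last:
  "v \<in> V \<Longrightarrow> (\<Sum>xs | set xs \<subseteq> V \<and> length xs = j. path_weight N (v # xs) * g (last (v # xs))) =
    (\<Sum>z\<in>V. walks j v z * g z)"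
proof (induction j arbitrary: v)
  case 0
  have "{xs. set xs \<subseteq> V \<and> length xs = 0} = {[]}" by auto
  then show ?case
    using finite_V 0 by (simp add: of_bool_def if_distrib[of "\<lambda>x. x * _"] cong: if_cong)
next
  case (Suc j)
  have "(\<Sum>xs | set xs \<subseteq> V \<and> length xs = Suc j. path_weight N (v # xs) * g (last (v # xs))) =
      (\<Sum>w\<in>V. N v w * (\<Sum>xs | set xs \<subseteq> V \<and> length xs = j. path_weight N (w # xs) * g (last (w # xs))))"
    by (simp add: sum_lists_Suc[OF finite_V] sum_distrib_left mult.assoc)
  also have "\<dots> = (\<Sum>w\<in>V. \<Sum>z\<in>V. N v w * (walks j w z * g z))"
    by (simp only: Suc.IH sum_distrib_left cong: sum.cong)
  also have "\<dots> = (\<Sum>z\<in>V. \<Sum>w\<in>V. N v w * (walks j w z * g z))" by (rule sum.swap)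
  finally show ?case by (simp add: sum_distrib_right mult.assoc)
qed

lemma sum_path_weight_ends:
  "(\<Sum>xs | set xs \<subseteq> V \<and> length xs = Suc j. path_weight N xs * g (hd xs) (last xs)) =
    (\<Sum>u\<in>V. \<Sum>v\<in>V. walks j u v * g u v)"
  unfolding sum_lists_Suc[OF finite_V]
  by (rule sum.cong[OF refl]) (use sum_path_weight_last in simp)

text \<open>The first \<open>j + 2\<close> vertices are kept as \<open>ys\<close>. Of the other
  \<open>j\<close> only the last one, \<open>z\<close>, is seen by \<open>g\<close>, so those in
  between sum out to \<open>walks j (last ys) z\<close>. For \<open>j = 0\<close> none remain and
  \<open>z\<close> is forced to be \<open>last ys\<close>.\<close>

lemma sum_cycle_weight:
  "(\<Sum>xs | set xs \<subseteq> V \<and> length xs = 2 * Suc j.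
      cycle_weight N xs * g (take (Suc (Suc j)) xs) (last xs)) =
    (\<Sum>ys | set ys \<subseteq> V \<and> length ys = Suc (Suc j).
      \<Sum>z\<in>V. path_weight N ys * walks j (last ys) z * N z (hd ys) * g ys z)"
proof -
  have len: "2 * Suc j = Suc (Suc j) + j" by simp
  show ?thesis unfolding len sum_lists_append
  proof (rule sum.cong[OF refl])
    fix ys assume "ys \<in> {ys. set ys \<subseteq> V \<and> length ys = Suc (Suc j)}"
    then have ys: "ys \<noteq> []" "length ys = Suc (Suc j)" and "set ys \<subseteq> V" by auto
    then have lV: "last ys \<in> V" using last_in_set by blast
    have w: "cycle_weight N (ys @ zs) = path_weight N ys *
        (path_weight N (last ys # zs) * N (last (last ys # zs)) (hd ys))" for zs
      using ys(1) path_weight_append[of ys N "zs @ [hd ys]"]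
        path_weight_append[of "last ys # zs" N "[hd ys]"]
      by (simp add: cycle_weight_def)
    have l: "last (ys @ zs) = last (last ys # zs)" for zs using ys(1) by simp
    have "(\<Sum>zs | set zs \<subseteq> V \<and> length zs = j.
        cycle_weight N (ys @ zs) * g (take (Suc (Suc j)) (ys @ zs)) (last (ys @ zs))) =
      path_weight N ys * (\<Sum>zs | set zs \<subseteq> V \<and> length zs = j. path_weight N (last ys # zs) *
        (N (last (last ys # zs)) (hd ys) * g ys (last (last ys # zs))))"
      unfolding w l sum_distrib_left using ys(2) by (simp add: mult_ac)
    also have "\<dots> = path_weight N ys * (\<Sum>z\<in>V. walks j (last ys) z * (N z (hd ys) * g ys z))"
      by (subst sum_path_weight_last[OF lV]) (rule refl)
    finally show "(\<Sum>zs | set zs \<subseteq> V \<and> length zs = j.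
        cycle_weight N (ys @ zs) * g (take (Suc (Suc j)) (ys @ zs)) (last (ys @ zs))) =
      (\<Sum>z\<in>V. path_weight N ys * walks j (last ys) z * N z (hd ys) * g ys z)"
      by (simp add: sum_distrib_left mult.assoc)
  qed
qed

text \<open>Cutting at two opposite vertices leaves two arcs of \<open>j + 1\<close> steps with the
  same ends, whence a sum of squares.\<close>

lemma sum_cycle_weight_eq_moment:
  "(\<Sum>xs | set xs \<subseteq> V \<and> length xs = 2 * Suc j. cycle_weight N xs) = moment (Suc j)"
proof -
  have "(\<Sum>xs | set xs \<subseteq> V \<and> length xs = 2 * Suc j. cycle_weight N xs) =
    (\<Sum>ys | set ys \<subseteq> V \<and> length ys = Suc (Suc j).
      \<Sum>z\<in>V. path_weight N ys * walks j (last ys) z * N z (hd ys))"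
    using sum_cycle_weight[where g = "\<lambda>_ _. 1"] by simp
  also have "\<dots> = (\<Sum>ys | set ys \<subseteq> V \<and> length ys = Suc (Suc j).
      path_weight N ys * walks (Suc j) (last ys) (hd ys))"
  proof (rule sum.cong[OF refl])
    fix ys assume "ys \<in> {ys. set ys \<subseteq> V \<and> length ys = Suc (Suc j)}"
    then have "ys \<noteq> []" "set ys \<subseteq> V" by auto
    then have "last ys \<in> V" "hd ys \<in> V" using last_in_set hd_in_set by blast+
    then show "(\<Sum>z\<in>V. path_weight N ys * walks j (last ys) z * N z (hd ys)) =
        path_weight N ys * walks (Suc j) (last ys) (hd ys)"
      by (simp only: walks_Suc_right sum_distrib_left mult.assoc)
  qed
  also have "\<dots> = (\<Sum>u\<in>V. \<Sum>v\<in>V. walks (Suc j) u v * walks (Suc j) v u)"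
    by (rule sum_path_weight_ends)
  also have "\<dots> = moment (Suc j)"
    unfolding moment_def power2_eq_square by (intro sum.cong refl) (metis walks_sym)
  finally show ?thesis .
qed

text \<open>The path is one term of a non-negative sum. The bound is what permits dividing by
  \<open>walks\<close> later: where \<open>walks\<close> vanishes, so does the path weight.\<close>

lemma path_weight_le_walks:
  assumes "set ys \<subseteq> V" "length ys = Suc j"
  shows "path_weight N ys \<le> walks j (hd ys) (last ys)"
proof -
  obtain u xs where ys: "ys = u # xs" using assms by (cases ys) auto
  have fin: "finite {xs. set xs \<subseteq> V \<and> length xs = j}"
    by (rule finite_lists_length_eq[OF finite_V])
  let ?f = "\<lambda>xs. path_weight N (u # xs) * of_bool (last (u # xs) = last ys)"
  have "0 \<le> ?f xs" for xs using path_weight_nonneg[of N "u # xs"] N_nonneg by simp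
  then have "?f xs \<le> (\<Sum>xs | set xs \<subseteq> V \<and> length xs = j. ?f xs)"
    by (intro member_le_sum[where f = ?f, OF _ _ fin]) (use assms ys in simp_all)
  also have "\<dots> = (\<Sum>z\<in>V. walks j u z * of_bool (z = last ys))"
    by (rule sum_path_weight_last) (use assms ys in auto)
  also have "\<dots> = walks j u (last ys)"
  proof -
    have "last ys \<in> V" using assms ys last_in_set by blast
    then show ?thesis
      using finite_V by (simp add: of_bool_def if_distrib[of "\<lambda>x. _ * x"] cong: if_cong)
  qed
  finally show ?thesis by (simp add: ys)
qed

text \<open>
  A closed walk of length \<open>2(j+1)\<close> is cut into a path \<open>ys\<close> of length \<open>j+1\<close>, one more vertex \<open>z\<close>
  next to its start, and a path of length \<open>j\<close> from \<open>z\<close> to the end of \<open>ys\<close>. Cauchy--Schwarz with the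
  splitting factor \<open>walks (j+1) / walks j\<close> turns the two factors into closed walks of lengths
  \<open>2(j+1)\<close> and \<open>2j\<close>.
\<close>

lemma sum_cycle_weight_conflict:
  fixes s Q :: real
  assumes "0 \<le> s"
    and s: "\<And>ys. set ys \<subseteq> V \<Longrightarrow> length ys = Suc (Suc j) \<Longrightarrow>
      card {z \<in> V. N z (hd ys) \<noteq> 0 \<and> R ys z} \<le> s"
    and Q: "\<And>z. z \<in> V \<Longrightarrow> (\<Sum>u\<in>V. (N z u)\<^sup>2) \<le> Q"
  shows "(\<Sum>xs | set xs \<subseteq> V \<and> length xs = 2 * Suc j.
      cycle_weight N xs * of_bool (R (take (Suc (Suc j)) xs) (last xs)))\<^sup>2
    \<le> (s * moment (Suc j)) * (Q * moment j)"
proof -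
  define L where "L = {ys. set ys \<subseteq> V \<and> length ys = Suc (Suc j)}"
  define W where "W ys = walks (Suc j) (hd ys) (last ys)" for ys
  define a where "a = (\<lambda>(ys, z). sqrt (path_weight N ys * W ys) *
      of_bool (N z (hd ys) \<noteq> 0 \<and> R ys z))"
  define b where "b = (\<lambda>(ys, z). sqrt (path_weight N ys / W ys) * (walks j (last ys) z * N z (hd ys)))"
  have pw0: "0 \<le> path_weight N ys" for ys by (rule path_weight_nonneg) (rule N_nonneg)
  have W0: "0 \<le> W ys" for ys unfolding W_def by (rule walks_nonneg)
  have pwW: "path_weight N ys \<le> W ys" if "ys \<in> L" for ys
    unfolding W_def by (rule path_weight_le_walks) (use that in \<open>auto simp: L_def\<close>)
  \<comment> \<open>If \<open>W ys\<close> is zero, so is the path weight and both sides vanish;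
    otherwise \<open>W ys\<close> cancels under the roots.\<close>
  have ab: "path_weight N ys * walks j (last ys) z * N z (hd ys) * of_bool (R ys z) =
      a (ys, z) * b (ys, z)" if "ys \<in> L" for ys z
  proof (cases "W ys = 0")
    case True
    then show ?thesis using pwW[OF that] pw0[of ys] by (simp add: a_def b_def)
  next
    case False
    have "sqrt (path_weight N ys * W ys) * sqrt (path_weight N ys / W ys) = path_weight N ys"
      using False W0[of ys] pw0[of ys] by (simp add: real_sqrt_mult[symmetric])
    then show ?thesis by (auto simp: a_def b_def)
  qed
  have "(\<Sum>xs | set xs \<subseteq> V \<and> length xs = 2 * Suc j.
      cycle_weight N xs * of_bool (R (take (Suc (Suc j)) xs) (last xs))) =
      (\<Sum>p\<in>L \<times> V. a p * b p)"
    unfolding sum_cycle_weight[where g = "\<lambda>ys z. of_bool (R ys z)"] L_def[symmetric]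
    by (simp add: ab sum.cartesian_product split_def)
  also have "(\<dots>)\<^sup>2 \<le> (\<Sum>p\<in>L \<times> V. (a p)\<^sup>2) * (\<Sum>p\<in>L \<times> V. (b p)\<^sup>2)"
    by (rule Cauchy_Schwarz_ineq_sum)
  also have "\<dots> \<le> (s * moment (Suc j)) * (Q * moment j)"
  proof (rule mult_mono)
    have "(\<Sum>p\<in>L \<times> V. (a p)\<^sup>2) = (\<Sum>ys\<in>L. \<Sum>z\<in>V. (a (ys, z))\<^sup>2)"
      by (simp add: sum.cartesian_product)
    \<comment> \<open>An indicator equals its square, so the sum over \<open>z\<close> counts the
      neighbours of \<open>hd ys\<close> with \<open>R ys z\<close>.\<close>
    also have "\<dots> = (\<Sum>ys\<in>L. path_weight N ys * W ys *
        card {z \<in> V. N z (hd ys) \<noteq> 0 \<and> R ys z})"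
      using finite_V by (simp add: a_def power_mult_distrib pw0 W0 sum_distrib_left[symmetric]
          sum.If_cases of_bool_def Int_def if_distrib[of "\<lambda>x. x\<^sup>2"] cong: if_cong)
    also have "\<dots> \<le> (\<Sum>ys\<in>L. path_weight N ys * W ys * s)"
      by (intro sum_mono mult_left_mono mult_nonneg_nonneg pw0 W0 s) (auto simp: L_def)
    also have "\<dots> = (\<Sum>ys\<in>L. path_weight N ys * W ys) * s"
      by (simp only: sum_distrib_right)
    also have "(\<Sum>ys\<in>L. path_weight N ys * W ys) = moment (Suc j)"
      unfolding L_def W_def sum_path_weight_ends moment_def power2_eq_square ..
    finally show "(\<Sum>p\<in>L \<times> V. (a p)\<^sup>2) \<le> s * moment (Suc j)" by (simp add: mult.commute)
  next
    let ?g = "\<lambda>u v. \<Sum>z\<in>V. (walks j v z)\<^sup>2 * (N z u)\<^sup>2"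
    have "(\<Sum>p\<in>L \<times> V. (b p)\<^sup>2) = (\<Sum>ys\<in>L. \<Sum>z\<in>V. (b (ys, z))\<^sup>2)"
      by (simp add: sum.cartesian_product)
    also have "\<dots> = (\<Sum>ys\<in>L. path_weight N ys * (?g (hd ys) (last ys) / W ys))"
      by (simp add: b_def power_mult_distrib pw0 W0 sum_distrib_left sum_divide_distrib)
    also have "\<dots> = (\<Sum>u\<in>V. \<Sum>v\<in>V. walks (Suc j) u v * (?g u v / walks (Suc j) u v))"
      unfolding L_def W_def by (rule sum_path_weight_ends)
    also have "\<dots> \<le> (\<Sum>u\<in>V. \<Sum>v\<in>V. ?g u v)"
    proof (intro sum_mono)
      fix u v
      have "0 \<le> ?g u v" by (intro sum_nonneg) simp
      \<comment> \<open>Where \<open>walks\<close> vanishes the quotient is 0 by convention, so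
        cancelling gives an inequality only.\<close>
      then show "walks (Suc j) u v * (?g u v / walks (Suc j) u v) \<le> ?g u v"
        by (cases "walks (Suc j) u v = 0") (simp_all del: walks.simps)
    qed
    also have "\<dots> = (\<Sum>v\<in>V. \<Sum>u\<in>V. ?g u v)" by (rule sum.swap)
    also have "\<dots> = (\<Sum>v\<in>V. \<Sum>z\<in>V. (walks j v z)\<^sup>2 * (\<Sum>u\<in>V. (N z u)\<^sup>2))"
      unfolding sum_distrib_left by (intro sum.cong refl sum.swap)
    also have "\<dots> \<le> (\<Sum>v\<in>V. \<Sum>z\<in>V. (walks j v z)\<^sup>2 * Q)"
      by (intro sum_mono mult_left_mono Q) auto
    also have "\<dots> = Q * moment j"
      by (simp add: moment_def sum_distrib_left mult.commute)
    finally show "(\<Sum>p\<in>L \<times> V. (b p)\<^sup>2) \<le> Q * moment j" .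
  next
    show "0 \<le> s * moment (Suc j)"
      using \<open>0 \<le> s\<close> by (auto simp: moment_def intro!: mult_nonneg_nonneg sum_nonneg simp del: walks.simps)
  qed (intro sum_nonneg, simp)
  finally show ?thesis .
qed

end

section \<open>Linear hypergraphs\<close>

text \<open>A smallest non-empty set spanning at least \<open>t\<close> edges per vertex works:
  deleting a vertex of degree below \<open>t\<close> would preserve the density.\<close>

lemma exists_min_degree_subset:
  fixes t :: real
  assumes fin: "finite V" "finite E" and E: "\<And>e. e \<in> E \<Longrightarrow> e \<subseteq> V \<and> e \<noteq> {}"
    and "V \<noteq> {}" and dense: "t * card V \<le> card E"
  shows "\<exists>U\<subseteq>V. U \<noteq> {} \<and> (\<forall>v\<in>U. t \<le> card {e \<in> E. v \<in> e \<and> e \<subseteq> U})"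
proof -
  define P where "P U \<longleftrightarrow> U \<subseteq> V \<and> U \<noteq> {} \<and> t * card U \<le> card {e \<in> E. e \<subseteq> U}" for U
  have "{e \<in> E. e \<subseteq> V} = E" using E by auto
  then have "P V" using assms by (simp add: P_def)
  then obtain U where U: "P U" and min: "\<And>W. P W \<Longrightarrow> card U \<le> card W"
    using ex_has_least_nat[of P V card] by blast
  have finU: "finite U" using U fin finite_subset P_def by blast
  have "t \<le> card {e \<in> E. v \<in> e \<and> e \<subseteq> U}" if v: "v \<in> U" for v
  proof (rule ccontr)
    assume small: "\<not> ?thesis"
    have "{e \<in> E. e \<subseteq> U} = {e \<in> E. e \<subseteq> U - {v}} \<union> {e \<in> E. v \<in> e \<and> e \<subseteq> U}" by auto
    moreover have "{e \<in> E. e \<subseteq> U - {v}} \<inter> {e \<in> E. v \<in> e \<and> e \<subseteq> U} = {}" by auto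
    ultimately have "card {e \<in> E. e \<subseteq> U} =
        card {e \<in> E. e \<subseteq> U - {v}} + card {e \<in> E. v \<in> e \<and> e \<subseteq> U}"
      using fin by (simp add: card_Un_disjoint)
    moreover have cU: "card U = Suc (card (U - {v}))" using v finU by (metis card_Suc_Diff1)
    ultimately have less: "t * card (U - {v}) < card {e \<in> E. e \<subseteq> U - {v}}"
      using small U by (simp add: P_def algebra_simps)
    \<comment> \<open>No edge fits into the empty set, so the strict inequality \<open>less\<close>
      excludes it.\<close>
    have "U - {v} \<noteq> {}"
    proof
      assume *: "U - {v} = {}"
      have none: "{e \<in> E. e \<subseteq> {}} = {}" using E by auto
      show False using less unfolding * none by simp
    qed
    then have "P (U - {v})" using U less by (auto simp: P_def)
    from min[OF this] show False using cU by simp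
  qed
  then show ?thesis using U by (auto simp: P_def)
qed

section \<open>Lines, degrees and the normalised 2-shadow\<close>

locale linear_system =
  fixes V :: "'a set" and E :: "'a set set" and r :: nat
  assumes finite_V: "finite V"
    and edge_subset: "e \<in> E \<Longrightarrow> e \<subseteq> V"
    and edge_card: "e \<in> E \<Longrightarrow> card e = r"
    and linear: "\<lbrakk>e \<in> E; f \<in> E; x \<in> e; y \<in> e; x \<in> f; y \<in> f; x \<noteq> y\<rbrakk> \<Longrightarrow> e = f"
    and r_ge_2: "r \<ge> 2"
begin

text \<open>Adjacency in the 2-shadow.\<close>

definition joined :: "'a \<Rightarrow> 'a \<Rightarrow> bool" where
  "joined x y \<longleftrightarrow> x \<noteq> y \<and> (\<exists>e\<in>E. x \<in> e \<and> y \<in> e)"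

text \<open>By linearity the union has at most one member, so joined vertices get their unique
  common edge; all other pairs get the empty set as a default.\<close>

definition line :: "'a \<Rightarrow> 'a \<Rightarrow> 'a set" where
  "line x y = (if x = y then {} else \<Union>{e \<in> E. x \<in> e \<and> y \<in> e})"

definition degree :: "'a \<Rightarrow> nat" where
  "degree x = card {y. joined x y}"

text \<open>The symmetrically normalised adjacency matrix of the 2-shadow.\<close>

definition kernel :: "'a \<Rightarrow> 'a \<Rightarrow> real" where
  "kernel x y = of_bool (joined x y) / sqrt (real (degree x) * real (degree y))"

lemma joined_sym: "joined x y = joined y x"
  by (auto simp: joined_def)

lemma joinedD: "joined x y \<Longrightarrow> x \<in> V \<and> y \<in> V"
  using edge_subset by (auto simp: joined_def)

lemma finite_edge: "e \<in> E \<Longrightarrow> finite e"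
  using edge_subset finite_V finite_subset by metis

lemma finite_joined: "finite {y. joined x y}"
  using finite_subset[OF _ finite_V] joinedD by blast

lemma line_eq: "\<lbrakk>e \<in> E; x \<in> e; y \<in> e; x \<noteq> y\<rbrakk> \<Longrightarrow> line x y = e"
proof -
  assume *: "e \<in> E" "x \<in> e" "y \<in> e" "x \<noteq> y"
  then have "{e \<in> E. x \<in> e \<and> y \<in> e} = {e}" using linear by blast
  then show ?thesis using * by (simp add: line_def)
qed

lemma line_joined: "joined x y \<Longrightarrow> line x y \<in> E \<and> x \<in> line x y \<and> y \<in> line x y"
  using line_eq by (auto simp: joined_def)

lemma line_not_joined: "\<not> joined x y \<Longrightarrow> line x y = {}"
  by (auto simp: joined_def line_def)

lemma finite_line: "finite (line x y)"
  using line_joined line_not_joined finite_edge by (cases "joined x y") auto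

lemma card_line_le: "card (line x y) \<le> r"
  using line_joined[of x y] line_not_joined[of x y] edge_card by (cases "joined x y") auto

text \<open>A second vertex chosen on each edge through \<open>x\<close> gives an injection into the
  neighbours, because two such edges share nothing but \<open>x\<close>.\<close>

lemma card_edges_le_degree: "card {e \<in> E. x \<in> e} \<le> degree x"
proof -
  have ex: "\<exists>y. y \<in> e \<and> y \<noteq> x" if "e \<in> E" for e
  proof (rule ccontr)
    assume "\<not> ?thesis"
    then have "e \<subseteq> {x}" by auto
    then have "card e \<le> 1" using card_mono[of "{x}" e] by simp
    then show False using edge_card[OF that] r_ge_2 by simp
  qed
  define g where "g e = (SOME y. y \<in> e \<and> y \<noteq> x)" for e
  have g: "g e \<in> e \<and> g e \<noteq> x" if "e \<in> E" for e
    unfolding g_def using someI_ex[OF ex[OF that]] .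
  show ?thesis unfolding degree_def
  proof (rule card_inj_on_le[where f = g])
    show "inj_on g {e \<in> E. x \<in> e}"
      by (rule inj_onI) (metis (mono_tags, lifting) g linear mem_Collect_eq)
    show "g ` {e \<in> E. x \<in> e} \<subseteq> {y. joined x y}" using g by (auto simp: joined_def)
  qed (rule finite_joined)
qed

sublocale weighted_graph V kernel
  by unfold_locales (auto simp: finite_V kernel_def joined_sym mult.commute)

text \<open>In row \<open>u\<close>, each of the \<open>degree u\<close> neighbours contributes
  \<open>1 / sqrt (degree u)\<close>, so the vector \<open>sqrt (degree u)\<close> is fixed.\<close>

lemma moment_kernel_ge_1:
  assumes "V \<noteq> {}" and pos: "\<And>v. v \<in> V \<Longrightarrow> 0 < degree v"
  shows "1 \<le> moment j"
proof (rule moment_ge_1)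
  fix u assume u: "u \<in> V"
  have "(\<Sum>w\<in>V. kernel u w * sqrt (degree w)) = (\<Sum>w\<in>V. of_bool (joined u w) / sqrt (degree u))"
    by (rule sum.cong) (auto simp: kernel_def real_sqrt_mult dest: pos)
  also have "\<dots> = (\<Sum>w\<in>{y. joined u y}. 1 / sqrt (degree u))"
    by (rule sum.mono_neutral_cong_right) (auto simp: finite_V dest: joinedD)
  also have "\<dots> = sqrt (degree u)"
    by (simp add: degree_def[symmetric] real_div_sqrt)
  finally show "(\<Sum>w\<in>V. kernel u w * sqrt (degree w)) = sqrt (degree u)" .
next
  show "0 < (\<Sum>u\<in>V. (sqrt (real (degree u)))\<^sup>2)"
    using assms finite_V by (intro sum_pos) auto
qed

lemma kernel_le:
  fixes t :: real
  assumes "0 < t" "\<And>v. v \<in> V \<Longrightarrow> t \<le> degree v"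
  shows "kernel x y \<le> 1 / t"
proof (cases "joined x y")
  case True
  then have "t * t \<le> real (degree x) * real (degree y)"
    using joinedD assms by (intro mult_mono) (auto intro: order_trans less_imp_le)
  then have "sqrt (t * t) \<le> sqrt (real (degree x) * real (degree y))" by (rule real_sqrt_le_mono)
  then have "t \<le> sqrt (real (degree x) * real (degree y))" using assms by simp
  then show ?thesis using True assms by (simp add: kernel_def frac_le)
qed (use assms in \<open>simp add: kernel_def\<close>)

text \<open>Row \<open>z\<close> has \<open>degree z\<close> nonzero entries, each with square at
  most \<open>1 / (degree z * t)\<close>.\<close>

lemma sum_kernel_square_le:
  fixes t :: real
  assumes "0 < t" "\<And>v. v \<in> V \<Longrightarrow> t \<le> degree v" and z: "z \<in> V"
  shows "(\<Sum>u\<in>V. (kernel z u)\<^sup>2) \<le> 1 / t"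
proof -
  have dz: "0 < real (degree z)" using assms(1) assms(2)[OF z] by linarith
  have "(\<Sum>u\<in>V. (kernel z u)\<^sup>2) = (\<Sum>u\<in>{y. joined z y}. (kernel z u)\<^sup>2)"
    by (rule sum.mono_neutral_right) (auto simp: finite_V kernel_def dest: joinedD)
  also have "\<dots> \<le> (\<Sum>u\<in>{y. joined z y}. 1 / (real (degree z) * t))"
  proof (rule sum_mono)
    fix u assume "u \<in> {y. joined z y}"
    then have "joined z u" "t \<le> degree u" using joinedD assms(2) by auto
    then show "(kernel z u)\<^sup>2 \<le> 1 / (real (degree z) * t)"
      using dz assms(1) by (auto simp: kernel_def power_divide intro!: frac_le mult_left_mono)
  qed
  also have "\<dots> = 1 / t" using dz by (simp add: degree_def[symmetric])
  finally show ?thesis .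
qed

text \<open>
  The condition \<open>hd ys \<notin> line (ys ! j) (ys ! Suc j)\<close> keeps the number of conflicting \<open>z\<close> bounded: if
  it fails, every line through \<open>hd ys\<close> meets \<open>line (ys ! j) (ys ! Suc j)\<close>. That configuration is caught
  by the first alternative at another rotation.
\<close>

definition conflict :: "'a list \<Rightarrow> 'a \<Rightarrow> bool" where
  "conflict ys z \<longleftrightarrow> (\<exists>j. Suc j < length ys \<and>
    (z \<in> line (ys ! j) (ys ! Suc j) \<or>
     hd ys \<notin> line (ys ! j) (ys ! Suc j) \<and> line z (hd ys) \<inter> line (ys ! j) (ys ! Suc j) \<noteq> {}))"

text \<open>Each of the \<open>k\<close> lines along \<open>ys\<close> rules out its own at most
  \<open>r\<close> points and, for each of its points \<open>w\<close>, the at most \<open>r\<close>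
  points on the line joining \<open>hd ys\<close> to \<open>w\<close>.\<close>

lemma card_conflict_le:
  assumes "length ys = Suc k"
  shows "card {z \<in> V. kernel z (hd ys) \<noteq> 0 \<and> conflict ys z} \<le> k * (r + r * r)"
proof -
  define f where "f j = line (ys ! j) (ys ! Suc j)" for j
  define A where "A j = f j \<union> (\<Union>w\<in>f j. line (hd ys) w)" for j
  have finf: "finite (f j)" "card (f j) \<le> r" for j
    unfolding f_def by (simp_all add: finite_line card_line_le)
  have "{z \<in> V. kernel z (hd ys) \<noteq> 0 \<and> conflict ys z} \<subseteq> (\<Union>j\<in>{..<k}. A j)"
  proof
    fix z assume "z \<in> {z \<in> V. kernel z (hd ys) \<noteq> 0 \<and> conflict ys z}"
    then have j: "joined z (hd ys)" and "conflict ys z" by (auto simp: kernel_def)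
    then obtain j where "j < k"
      and c: "z \<in> f j \<or> hd ys \<notin> f j \<and> line z (hd ys) \<inter> f j \<noteq> {}"
      using assms by (auto simp: conflict_def f_def)
    have "z \<in> A j"
    proof (cases "z \<in> f j")
      case False
      \<comment> \<open>In this case \<open>hd ys\<close> is off \<open>f j\<close>, so the common
        point \<open>w\<close> differs from it and determines the line through
        \<open>z\<close>.\<close>
      then obtain w where w: "w \<in> line z (hd ys)" "w \<in> f j" "w \<noteq> hd ys" using c by auto
      then have "line (hd ys) w = line z (hd ys)" using line_joined[OF j] line_eq by metis
      then have "z \<in> line (hd ys) w" using line_joined[OF j] by simp
      then show ?thesis using w by (auto simp: A_def)
    qed (simp add: A_def)
    then show "z \<in> (\<Union>j\<in>{..<k}. A j)" using \<open>j < k\<close> by auto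
  qed
  moreover have finA: "finite (A j)" for j using finf finite_line by (auto simp: A_def)
  ultimately have "card {z \<in> V. kernel z (hd ys) \<noteq> 0 \<and> conflict ys z} \<le> card (\<Union>j\<in>{..<k}. A j)"
    by (intro card_mono) auto
  also have "\<dots> \<le> (\<Sum>j<k. card (A j))" by (rule card_UN_le) simp
  also have "\<dots> \<le> (\<Sum>j<k. r + r * r)"
  proof (rule sum_mono)
    fix j
    have "card (\<Union>w\<in>f j. line (hd ys) w) \<le> (\<Sum>w\<in>f j. card (line (hd ys) w))"
      by (rule card_UN_le) (rule finf)
    also have "\<dots> \<le> (\<Sum>w\<in>f j. r)" by (rule sum_mono) (rule card_line_le)
    also have "\<dots> \<le> r * r" using finf[of j] by simp
    finally have "card (\<Union>w\<in>f j. line (hd ys) w) \<le> r * r" .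
    then show "card (A j) \<le> r + r * r"
      unfolding A_def using card_Un_le[of "f j" "\<Union>w\<in>f j. line (hd ys) w"] finf(2)[of j] by linarith
  qed
  finally show ?thesis by simp
qed

section \<open>Counting closed walks without conflicts\<close>

text \<open>In a rotation, \<open>last\<close> is the cyclic predecessor of the head, and the first
  \<open>k + 1\<close> entries carry the next \<open>k\<close> steps. Ranging over \<open>n\<close>
  tests every starting point.\<close>

definition clean_cycles :: "nat \<Rightarrow> 'a list set" where
  "clean_cycles k = {xs. set xs \<subseteq> V \<and> length xs = 2 * k \<and> cycle_weight kernel xs \<noteq> 0 \<and>
    (\<forall>n. \<not> conflict (take (Suc k) (rotate n xs)) (last (rotate n xs)))}"

text \<open>Walks with a conflict at some rotation carry at most half of \<open>moment k\<close>,
  which is at least 1. A single walk weighs at most \<open>(1 / t) ^ (2 * k)\<close>, so many clean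
  ones are needed to carry the rest.\<close>

lemma card_clean_cycles_ge:
  fixes t :: real
  assumes "V \<noteq> {}" "k \<ge> 1" and t: "0 < t" "\<And>v. v \<in> V \<Longrightarrow> t \<le> degree v"
    and large: "16 * k\<^sup>2 * (k * (r + r * r)) * root k (card V) \<le> t"
  shows "t ^ (2 * k) / 2 \<le> card (clean_cycles k)"
proof -
  obtain j where k: "k = Suc j" using \<open>k \<ge> 1\<close> by (cases k) auto
  define L where "L = {xs. set xs \<subseteq> V \<and> length xs = 2 * k}"
  define c where "c xs \<longleftrightarrow> conflict (take (Suc k) xs) (last xs)" for xs
  define s where "s = real (k * (r + r * r))"
  define B where "B = (\<Sum>xs\<in>L. cycle_weight kernel xs * of_bool (c xs))"
  have finL: "finite L" unfolding L_def by (rule finite_lists_length_eq[OF finite_V])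
  have cw0: "0 \<le> cycle_weight kernel xs" for xs
    unfolding cycle_weight_def by (rule path_weight_nonneg) (rule N_nonneg)
  have degpos: "0 < degree v" if "v \<in> V" for v using t(1) t(2)[OF that] by linarith
  have m1: "1 \<le> moment i" for i by (rule moment_kernel_ge_1[OF \<open>V \<noteq> {}\<close> degpos])
  have "B\<^sup>2 \<le> (s * moment k) * ((1 / t) * moment j)"
    unfolding B_def L_def c_def k s_def
    by (rule sum_cycle_weight_conflict)
      (use card_conflict_le sum_kernel_square_le[OF t] in \<open>auto simp del: of_nat_mult of_nat_add mult_Suc\<close>)
  also have "\<dots> \<le> (s * moment k) * ((1 / t) * (root k (card V) * moment k))"
    using m1[of k] t(1) moment_le_root[of j, OF m1]
    by (intro mult_left_mono) (auto simp: k s_def divide_right_mono intro!: mult_nonneg_nonneg)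
  also have "\<dots> = (s * root k (card V) / t) * (moment k)\<^sup>2"
    by (simp add: power2_eq_square)
  \<comment> \<open>The root of this factor is \<open>1 / (4 * k)\<close>, so the
    \<open>2 * k\<close> rotations together cost half of \<open>moment k\<close>.\<close>
  also have "\<dots> \<le> (1 / (16 * k\<^sup>2)) * (moment k)\<^sup>2"
  proof (rule mult_right_mono)
    have "s * root k (card V) * (16 * k\<^sup>2) \<le> t"
      using large by (simp add: s_def algebra_simps)
    then show "s * root k (card V) / t \<le> 1 / (16 * k\<^sup>2)"
      using t(1) \<open>k \<ge> 1\<close> by (simp add: field_simps)
  qed simp
  also have "\<dots> = (moment k / (4 * k))\<^sup>2" by (simp add: power_divide power_mult_distrib)
  finally have "B \<le> moment k / (4 * k)"
    by (rule power2_le_imp_le) (use m1[of k] in simp)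
  then have B: "2 * k * B \<le> moment k / 2" using \<open>k \<ge> 1\<close> by (simp add: field_simps)
  have cover: "cycle_weight kernel xs \<le> cycle_weight kernel xs * of_bool (xs \<in> clean_cycles k) +
      (\<Sum>n<2 * k. cycle_weight kernel xs * of_bool (c (rotate n xs)))" if xs: "xs \<in> L" for xs
  proof (cases "xs \<in> clean_cycles k \<or> cycle_weight kernel xs = 0")
    case True
    then show ?thesis using cw0[of xs] by (auto intro!: sum_nonneg)
  next
    case False
    then obtain n where "c (rotate n xs)" using xs by (auto simp: clean_cycles_def L_def c_def)
    then have n: "c (rotate (n mod (2 * k)) xs)" using xs rotate_conv_mod[of n xs] by (simp add: L_def)
    have "cycle_weight kernel xs * of_bool (c (rotate (n mod (2 * k)) xs)) \<le>
        (\<Sum>n<2 * k. cycle_weight kernel xs * of_bool (c (rotate n xs)))"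
      by (rule member_le_sum) (use \<open>k \<ge> 1\<close> cw0 in auto)
    then show ?thesis using n False by simp
  qed
  \<comment> \<open>Rotation permutes \<open>L\<close> and preserves weights, so every rotation
    index contributes the same \<open>B\<close>.\<close>
  have shift: "(\<Sum>xs\<in>L. cycle_weight kernel xs * of_bool (c (rotate n xs))) = B" for n
    using sum_lists_rotate[OF finite_V, of "\<lambda>xs. cycle_weight kernel xs * of_bool (c xs)" n "2 * k"]
    by (simp add: B_def L_def cycle_weight_rotate)
  have "moment k = (\<Sum>xs\<in>L. cycle_weight kernel xs)"
    unfolding L_def k by (rule sum_cycle_weight_eq_moment[symmetric])
  also have "\<dots> \<le> (\<Sum>xs\<in>L. cycle_weight kernel xs * of_bool (xs \<in> clean_cycles k)) +
      (\<Sum>xs\<in>L. \<Sum>n<2 * k. cycle_weight kernel xs * of_bool (c (rotate n xs)))"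
    unfolding sum.distrib[symmetric] by (rule sum_mono) (rule cover)
  also have "(\<Sum>xs\<in>L. \<Sum>n<2 * k. cycle_weight kernel xs * of_bool (c (rotate n xs))) = 2 * k * B"
    by (subst sum.swap) (simp add: shift)
  also have "(\<Sum>xs\<in>L. cycle_weight kernel xs * of_bool (xs \<in> clean_cycles k)) =
      (\<Sum>xs\<in>clean_cycles k. cycle_weight kernel xs)"
    by (rule sum.mono_neutral_cong_right[OF finL]) (auto simp: L_def clean_cycles_def)
  also have "\<dots> \<le> (\<Sum>xs\<in>clean_cycles k. (1 / t) ^ (2 * k))"
  proof (rule sum_mono)
    fix xs assume "xs \<in> clean_cycles k"
    then have len: "length xs = 2 * k" by (simp add: clean_cycles_def)
    have "path_weight kernel (xs @ [hd xs]) \<le> (1 / t) ^ (length (xs @ [hd xs]) - 1)"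
      by (rule path_weight_le_power) (rule N_nonneg, rule kernel_le[OF t])
    then show "cycle_weight kernel xs \<le> (1 / t) ^ (2 * k)"
      by (simp only: cycle_weight_def length_append list.size len) simp
  qed
  finally have "1 / 2 \<le> card (clean_cycles k) * (1 / t) ^ (2 * k)" using B m1[of k] by simp
  then show ?thesis using t(1) by (simp add: field_simps)
qed

section \<open>Geometry of closed walks without conflicts\<close>

text \<open>\<open>A\<close> and \<open>B\<close> express the absence of conflicts at every position
  of a periodic sequence. Lines at cyclic distance 2 or more are then disjoint and consecutive ones
  share only their common vertex, which is the incidence pattern of a linear cycle.\<close>

lemma clean_cycle_lines:
  fixes x :: "nat \<Rightarrow> 'a" and F :: "nat \<Rightarrow> 'a set"
  assumes "k \<ge> 2" and per: "\<And>i. x (i + 2 * k) = x i" and adj: "\<And>i. joined (x i) (x (Suc i))"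
    and F: "\<And>i. F i = line (x i) (x (Suc i))"
    and A: "\<And>n j. j < k \<Longrightarrow> x n \<notin> F (Suc n + j)"
    and B: "\<And>n j. j < k \<Longrightarrow> x (Suc n) \<in> F (Suc n + j) \<or> F n \<inter> F (Suc n + j) = {}"
  shows "\<And>i l. \<lbrakk>i < 2 * k; l < 2 * k; x l \<in> F i\<rbrakk> \<Longrightarrow> l = i \<or> l = Suc i mod (2 * k)"
    and "\<And>i l. \<lbrakk>i < 2 * k; l < 2 * k; i \<noteq> l\<rbrakk> \<Longrightarrow> F i \<inter> F l \<subseteq> {x i, x l}"
    and "inj_on x {..<2 * k}"
proof -
  have perF: "F (i + 2 * k) = F i" for i using per[of i] per[of "Suc i"] by (simp add: F)
  have FE: "F i \<in> E" "x i \<in> F i" "x (Suc i) \<in> F i" for i using line_joined[OF adj] by (auto simp: F)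
  have near: "F n \<inter> F (n + d) = {}" if "2 \<le> d" "d \<le> k" for n d
  proof -
    \<comment> \<open>\<open>A\<close> one position later rules out the exceptional case of
      \<open>B\<close>.\<close>
    have "x (Suc n) \<notin> F (Suc (Suc n) + (d - 2))" using that by (intro A) auto
    moreover have "Suc (Suc n) + (d - 2) = n + d" "Suc n + (d - 1) = n + d" using that by auto
    ultimately show ?thesis using B[of "d - 1" n] that by auto
  qed
  have far: "F n \<inter> F (n + d) = {}" if "2 \<le> d" "d \<le> 2 * k - 2" for n d
  proof (cases "d \<le> k")
    case False
    \<comment> \<open>A distance above \<open>k\<close> is measured the other way round the cycle,
      where it is \<open>2 * k - d\<close>.\<close>
    have "F (n + d) \<inter> F ((n + d) + (2 * k - d)) = {}" using that False by (intro near) auto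
    moreover have "(n + d) + (2 * k - d) = n + 2 * k" using that by auto
    ultimately show ?thesis using perF[of n] by auto
  qed (use that near in auto)
  have no_next: "x n \<notin> F (Suc n)" for n using A[of 0 n] \<open>k \<ge> 2\<close> by simp
  have consec: "F n \<inter> F (Suc n) \<subseteq> {x (Suc n)}" for n
    using linear[of "F n" "F (Suc n)" "x (Suc n)"] FE no_next by blast
  have wrap: "F (2 * k) = F 0" "x (2 * k) = x 0" using perF[of 0] per[of 0] by simp_all
  \<comment> \<open>The vertex \<open>x l\<close> lies on \<open>F l\<close>, which is disjoint from
    \<open>F i\<close> at cyclic distance 2 or more; when \<open>i\<close> follows \<open>l\<close>,
    \<open>no_next\<close> applies.\<close>
  show inc: "l = i \<or> l = Suc i mod (2 * k)" if il: "i < 2 * k" "l < 2 * k" "x l \<in> F i" for i l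
  proof (rule ccontr)
    assume ne: "\<not> ?thesis"
    show False
    proof (cases "i < l")
      case True
      then have "Suc i \<noteq> l" using ne il by auto
      show False
      proof (cases "l - i \<le> 2 * k - 2")
        case True
        moreover have "2 \<le> l - i" using \<open>i < l\<close> \<open>Suc i \<noteq> l\<close> by linarith
        ultimately show False using far[of "l - i" i] \<open>i < l\<close> il FE(2)[of l] by auto
      next
        case False
        then have "i = 0" "Suc l = 2 * k" using il by auto
        then show False using no_next[of l] wrap il by simp
      qed
    next
      case False
      then have "l < i" using ne by auto
      show False
      proof (cases "Suc l = i")
        case True
        then show False using no_next il by auto
      next
        case False
        then have "2 \<le> i - l" using \<open>l < i\<close> by linarith
        moreover have "i - l \<le> 2 * k - 2"
          using il ne \<open>l < i\<close> by (cases "Suc i = 2 * k") auto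
        ultimately show False using far[of "i - l" l] \<open>l < i\<close> il FE(2)[of l] by auto
      qed
    qed
  qed
  have meet: "F i \<inter> F l \<subseteq> {x i, x l}" if "i < l" "l < 2 * k" for i l
  proof -
    have "l = Suc i \<or> (2 \<le> l - i \<and> l - i \<le> 2 * k - 2) \<or> (i = 0 \<and> Suc l = 2 * k)"
      using that by linarith
    then consider "l = Suc i" | "2 \<le> l - i" "l - i \<le> 2 * k - 2" | "i = 0" "Suc l = 2 * k"
      by blast
    then show ?thesis
    proof cases
      case 1
      then show ?thesis using consec by blast
    next
      case 2
      then show ?thesis using far[of "l - i" i] that by auto
    next
      case 3
      then show ?thesis using consec[of l] wrap by auto
    qed
  qed
  show "F i \<inter> F l \<subseteq> {x i, x l}" if "i < 2 * k" "l < 2 * k" "i \<noteq> l" for i l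
    using meet[of i l] meet[of l i] that by (cases "i < l") auto
  show "inj_on x {..<2 * k}"
  proof (rule linorder_inj_onI)
    fix i l assume il: "i < l" "i \<in> {..<2 * k}" "l \<in> {..<2 * k}"
    show "x i \<noteq> x l"
    proof
      assume "x i = x l"
      then have "x i \<in> F l" "x l \<in> F i" using FE(2)[of i] FE(2)[of l] by auto
      \<comment> \<open>Each index would be the cyclic successor of the other, which is impossible
        in a cycle of length at least 4.\<close>
      then have i: "i = Suc l mod (2 * k)" and l: "l = Suc i mod (2 * k)"
        using inc[of l i] inc[of i l] il by auto
      have "Suc l = 2 * k"
      proof (rule ccontr)
        assume "Suc l \<noteq> 2 * k"
        then have "Suc l mod (2 * k) = Suc l" using il by simp
        then show False using i il by linarith
      qed
      then have "i = 0" using i by simp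
      then have "l = 1" using l \<open>k \<ge> 2\<close> by simp
      then show False using \<open>Suc l = 2 * k\<close> \<open>k \<ge> 2\<close> by simp
    qed
  qed auto
qed

end

section \<open>Recognising a copy of the linear cycle\<close>

text \<open>The model vertex \<open>(i, 0)\<close> is sent to \<open>x i\<close>, and
  \<open>{i} \<times> {1..<r - 1}\<close> by any bijection to the other \<open>r - 2\<close>
  vertices of \<open>F i\<close>. By \<open>inc\<close> and \<open>meet\<close> these belong to no
  other \<open>F l\<close>, so the map is injective.\<close>

lemma linear_cycle_copy:
  fixes x :: "nat \<Rightarrow> 'a" and F :: "nat \<Rightarrow> 'a set"
  assumes "hypergraph G" "r \<ge> 2" "m \<ge> 2"
    and F: "\<And>i. i < m \<Longrightarrow> F i \<in> edges G \<and> card (F i) = r \<and> x i \<in> F i \<and> x (Suc i mod m) \<in> F i"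
    and inj: "inj_on x {..<m}"
    and inc: "\<And>i l. \<lbrakk>i < m; l < m; x l \<in> F i\<rbrakk> \<Longrightarrow> l = i \<or> l = Suc i mod m"
    and meet: "\<And>i l. \<lbrakk>i < m; l < m; i \<noteq> l\<rbrakk> \<Longrightarrow> F i \<inter> F l \<subseteq> {x i, x l}"
  shows "\<lparr>verts = (\<Union>i<m. F i), edges = F ` {..<m}\<rparr> \<in> copies (linear_cycle r m) G"
proof -
  define e where "e i = {(i, 0), (Suc i mod m, 0)} \<union> {i} \<times> {1..<r - 1}" for i :: nat
  define D where "D = {..<m} \<times> {..<r - 1}"
  have sm: "Suc i mod m < m" for i using \<open>m \<ge> 2\<close> by simp
  have finF: "finite (F i)" if "i < m" for i
    using F[OF that] \<open>r \<ge> 2\<close> by (metis card.infinite not_numeral_le_zero)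
  have "\<exists>h. bij_betw h {1..<r - 1} (F i - {x i, x (Suc i mod m)})" if "i < m" for i
  proof (rule finite_same_card_bij)
    have "Suc i mod m \<noteq> i" using that \<open>m \<ge> 2\<close> by (cases "Suc i = m") auto
    then have "x i \<noteq> x (Suc i mod m)" using inj_onD[OF inj, of i "Suc i mod m"] that sm by auto
    then show "card {1..<r - 1} = card (F i - {x i, x (Suc i mod m)})"
      using F[OF that] finF[OF that] by (simp add: card_Diff_subset)
  qed (use finF[OF that] in auto)
  then obtain b where b: "\<And>i. i < m \<Longrightarrow> bij_betw (b i) {1..<r - 1} (F i - {x i, x (Suc i mod m)})"
    by metis
  have b_in: "b i t \<in> F i - {x i, x (Suc i mod m)}" if "i < m" "0 < t" "t < r - 1" for i t
    using bij_betwE[OF b[OF that(1)]] that by auto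
  have b_new: "b i t \<noteq> x l" if "i < m" "0 < t" "t < r - 1" "l < m" for i t l
    using b_in[OF that(1-3)] inc[of i l] that by auto
  define g where "g = (\<lambda>(i, t). if t = 0 then x i else b i t)"
  have injg: "inj_on g D"
  proof (rule inj_onI, clarsimp simp: D_def g_def)
    fix i t i' t'
    assume lt: "i < m" "t < r - Suc 0" "i' < m" "t' < r - Suc 0"
      and eq: "(if t = 0 then x i else b i t) = (if t' = 0 then x i' else b i' t')"
    show "i = i' \<and> t = t'"
    proof (cases "t = 0 \<or> t' = 0")
      case True
      then show ?thesis
        using eq lt b_new[of i t i'] b_new[of i' t' i] inj_onD[OF inj, of i i']
        by (auto split: if_splits)
    next
      case False
      then have bb: "b i t = b i' t'" using eq by auto
      have "i = i'"
      proof (rule ccontr)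
        assume "i \<noteq> i'"
        then have "b i t \<in> {x i, x i'}"
          using meet[of i i'] b_in[of i t] b_in[of i' t'] bb lt False by auto
        then show False using b_new[of i t i] b_new[of i t i'] lt False by auto
      qed
      then show ?thesis
        using bb inj_onD[OF bij_betw_imp_inj_on[OF b[OF lt(1)]], of t t'] lt False by auto
    qed
  qed
  have ge: "g ` e i = F i" if "i < m" for i
  proof -
    have "g ` ({i} \<times> {1..<r - 1}) = b i ` {1..<r - 1}"
      by (force simp: g_def image_iff)
    also have "\<dots> = F i - {x i, x (Suc i mod m)}" using b[OF that] by (simp add: bij_betw_def)
    finally show ?thesis unfolding e_def image_Un using F[OF that] by (auto simp: g_def)
  qed
  have De: "D = (\<Union>i<m. e i)"
    using \<open>r \<ge> 2\<close> sm by (fastforce simp: D_def e_def)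
  have gD: "g ` D = (\<Union>i<m. F i)" unfolding De image_UN using ge by auto
  have bij: "bij_betw g D (\<Union>i<m. F i)" using injg gD by (simp add: bij_betw_def)
  \<comment> \<open>\<open>isomorphic\<close> asks for a map from the copy to the model, hence the
    inverse of \<open>g\<close>.\<close>
  have "inv_into D g ` F i = e i" if "i < m" for i
  proof -
    have "e i \<subseteq> D" unfolding De using that by auto
    then show ?thesis using inv_into_image_cancel[OF injg] ge[OF that] by metis
  qed
  then have im: "(\<lambda>f. inv_into D g ` f) ` (F ` {..<m}) = e ` {..<m}"
    unfolding image_image by (intro image_cong) auto
  have "linear_cycle r m = \<lparr>verts = D, edges = e ` {..<m}\<rparr>"
    by (simp add: linear_cycle_def D_def e_def)
  then have "isomorphic \<lparr>verts = (\<Union>i<m. F i), edges = F ` {..<m}\<rparr> (linear_cycle r m)"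
    unfolding isomorphic_def using bij_betw_inv_into[OF bij] im
    by (intro exI[of _ "inv_into D g"]) simp
  moreover have "subhypergraph \<lparr>verts = (\<Union>i<m. F i), edges = F ` {..<m}\<rparr> G"
    using F finF \<open>hypergraph G\<close> by (auto simp: subhypergraph_def hypergraph_def)
  ultimately show ?thesis by (simp add: copies_def)
qed

lemma finite_copies:
  assumes "hypergraph G"
  shows "finite (copies H G)"
proof (rule finite_subset)
  have "finite (verts G)" "edges G \<subseteq> Pow (verts G)" using assms by (auto simp: hypergraph_def)
  then show "finite ((\<lambda>(A, B). \<lparr>verts = A, edges = B\<rparr>) ` (Pow (verts G) \<times> Pow (edges G)))"
    by (simp add: finite_subset)
  show "copies H G \<subseteq> (\<lambda>(A, B). \<lparr>verts = A, edges = B\<rparr>) ` (Pow (verts G) \<times> Pow (edges G))"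
  proof
    fix K assume "K \<in> copies H G"
    then have "verts K \<subseteq> verts G" "edges K \<subseteq> edges G" by (auto simp: copies_def subhypergraph_def)
    then have "(verts K, edges K) \<in> Pow (verts G) \<times> Pow (edges G)" by simp
    then show "K \<in> (\<lambda>(A, B). \<lparr>verts = A, edges = B\<rparr>) ` (Pow (verts G) \<times> Pow (edges G))"
      by (rule rev_image_eqI) simp
  qed
qed

section \<open>From clean closed walks to copies\<close>

context linear_system
begin

text \<open>The walk is read as a sequence \<open>x\<close> of period \<open>2 * k\<close>. Rotating
  by \<open>n + 1\<close> puts \<open>x (n + 1)\<close> first and \<open>x n\<close> last, so
  cleanness yields the hypotheses of \<open>clean_cycle_lines\<close>. Containment of
  \<open>set xs\<close> serves to bound the number of walks per copy.\<close>

lemma clean_cycle_copy: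
  assumes "k \<ge> 2" and G: "hypergraph G" "E \<subseteq> edges G" and xs: "xs \<in> clean_cycles k"
  shows "\<exists>K\<in>copies (linear_cycle r (2 * k)) G. set xs \<subseteq> verts K"
proof -
  have len: "length xs = 2 * k" and cw: "cycle_weight kernel xs \<noteq> 0"
    and clean: "\<And>n. \<not> conflict (take (Suc k) (rotate n xs)) (last (rotate n xs))"
    using xs by (auto simp: clean_cycles_def)
  define x where "x i = xs ! (i mod (2 * k))" for i
  define F where "F i = line (x i) (x (Suc i))" for i
  have per: "x (i + 2 * k) = x i" for i by (simp add: x_def)
  have x_mod: "x (i mod (2 * k)) = x i" for i by (simp add: x_def)
  have adj: "joined (x i) (x (Suc i))" for i
  proof -
    have "kernel (xs ! (i mod (2 * k))) (xs ! (Suc (i mod (2 * k)) mod (2 * k))) \<noteq> 0"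
      using cycle_weight_nonzeroD[OF cw, of "i mod (2 * k)"] len \<open>k \<ge> 2\<close> by simp
    then show ?thesis by (simp add: kernel_def x_def mod_Suc_eq)
  qed
  have not_conflict: "x n \<notin> F (Suc n + j) \<and> (x (Suc n) \<in> F (Suc n + j) \<or> F n \<inter> F (Suc n + j) = {})"
    if j: "j < k" for n j
  proof -
    define ys where "ys = take (Suc k) (rotate (Suc n) xs)"
    have rot: "rotate (Suc n) xs ! i = x (Suc n + i)" if "i < 2 * k" for i
      using that len nth_rotate[of i xs "Suc n"] by (simp add: x_def del: rotate_Suc)
    have ys: "length ys = Suc k" "\<And>i. i \<le> k \<Longrightarrow> ys ! i = x (Suc n + i)"
      using len \<open>k \<ge> 2\<close> rot by (auto simp: ys_def simp del: rotate_Suc)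
    have "ys \<noteq> []" using ys(1) by auto
    then have hd: "hd ys = x (Suc n)" using ys(2)[of 0] by (simp add: hd_conv_nth)
    have "last (rotate (Suc n) xs) = rotate (Suc n) xs ! (2 * k - 1)"
      using len \<open>k \<ge> 2\<close> by (subst last_conv_nth) (auto simp del: rotate_Suc)
    also have "\<dots> = x (n + 2 * k)" using \<open>k \<ge> 2\<close> by (subst rot) auto
    finally have "last (rotate (Suc n) xs) = x n" by (simp add: per)
    then have "\<not> conflict ys (x n)" using clean[of "Suc n"] by (simp add: ys_def)
    then have "x n \<notin> line (ys ! j) (ys ! Suc j) \<and>
        (hd ys \<in> line (ys ! j) (ys ! Suc j) \<or> line (x n) (hd ys) \<inter> line (ys ! j) (ys ! Suc j) = {})"
      unfolding conflict_def using j ys(1) by (metis Suc_mono)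
    then show ?thesis using ys(2)[of j] ys(2)[of "Suc j"] j by (simp add: hd F_def)
  qed
  note lines = clean_cycle_lines[OF \<open>k \<ge> 2\<close> per adj F_def]
  have "\<lparr>verts = (\<Union>i<2 * k. F i), edges = F ` {..<2 * k}\<rparr> \<in> copies (linear_cycle r (2 * k)) G"
  proof (rule linear_cycle_copy[where x = x, OF G(1) r_ge_2])
    show "F i \<in> edges G \<and> card (F i) = r \<and> x i \<in> F i \<and> x (Suc i mod (2 * k)) \<in> F i" for i
      using line_joined[OF adj[of i]] edge_card G(2) by (auto simp: F_def x_mod)
    show "inj_on x {..<2 * k}" using lines(3) not_conflict by blast
    show "l = i \<or> l = Suc i mod (2 * k)" if "i < 2 * k" "l < 2 * k" "x l \<in> F i" for i l
      using lines(1)[OF _ _ that] not_conflict by blast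
    show "F i \<inter> F l \<subseteq> {x i, x l}" if "i < 2 * k" "l < 2 * k" "i \<noteq> l" for i l
      using lines(2)[OF _ _ that] not_conflict by blast
  qed (use \<open>k \<ge> 2\<close> in simp)
  moreover have "set xs \<subseteq> (\<Union>i<2 * k. F i)"
  proof
    fix v assume "v \<in> set xs"
    then obtain i where "i < 2 * k" "v = x i" using len by (auto simp: in_set_conv_nth x_def)
    then show "v \<in> (\<Union>i<2 * k. F i)" using line_joined[OF adj[of i]] by (auto simp: F_def)
  qed
  ultimately show ?thesis by force
qed

text \<open>Each clean walk is a word of length \<open>2 * k\<close> over the
  \<open>2 * k * (r - 1)\<close> vertices of some copy.\<close>

lemma card_clean_cycles_le:
  assumes "k \<ge> 2" and G: "hypergraph G" "E \<subseteq> edges G"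
  shows "card (clean_cycles k) \<le> card (copies (linear_cycle r (2 * k)) G) * (2 * k * (r - 1)) ^ (2 * k)"
proof -
  let ?K = "copies (linear_cycle r (2 * k)) G"
  let ?L = "\<lambda>K. {xs. set xs \<subseteq> verts K \<and> length xs = 2 * k}"
  have K: "finite (verts K) \<and> card (verts K) = 2 * k * (r - 1)" if "K \<in> ?K" for K
  proof -
    have "card (verts K) = card (verts (linear_cycle r (2 * k)))"
      using that by (auto simp: copies_def isomorphic_def dest: bij_betw_same_card)
    then show ?thesis using that by (auto simp: copies_def subhypergraph_def hypergraph_def linear_cycle_def)
  qed
  have fin: "finite ?K" by (rule finite_copies[OF G(1)])
  have "clean_cycles k \<subseteq> (\<Union>K\<in>?K. ?L K)"
    using clean_cycle_copy[OF assms] by (fastforce simp: clean_cycles_def)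
  then have "card (clean_cycles k) \<le> card (\<Union>K\<in>?K. ?L K)"
    using fin K by (intro card_mono finite_UN_I) (auto intro: finite_lists_length_eq)
  also have "\<dots> \<le> (\<Sum>K\<in>?K. card (?L K))" by (rule card_UN_le[OF fin])
  also have "\<dots> = (\<Sum>K\<in>?K. (2 * k * (r - 1)) ^ (2 * k))"
    using K by (intro sum.cong refl) (simp add: card_lists_length_eq)
  finally show ?thesis by simp
qed

end

section \<open>Choice of constants and passage to the pruned hypergraph\<close>

theorem theorem1p2:
  fixes k r :: nat
  assumes "k \<ge> 2" and "r \<ge> 2"
  shows "\<exists>C c :: real. C > 0 \<and> c > 0 \<and>
    (\<forall>(G :: 'a hypergraph) (n :: nat).
      r_graph r G \<and> linear_hypergraph G \<and> card (verts G) = n \<and>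
      real (card (edges G)) \<ge> C * real n powr (1 + 1 / real k) \<longrightarrow>
      real (card (copies (linear_cycle r (2 * k)) G)) \<ge>
        c * (real (card (edges G)) / real n) ^ (2 * k))"
proof -
  \<comment> \<open>\<open>C\<close> is the factor required by \<open>card_clean_cycles_ge\<close>,
    and \<open>M\<close> bounds the clean walks per copy.\<close>
  define C :: real where "C = real (16 * k\<^sup>2 * (k * (r + r * r)))"
  define M :: real where "M = real ((2 * k * (r - 1)) ^ (2 * k))"
  have Cpos: "C > 0" unfolding C_def of_nat_0_less_iff using assms by simp
  have Mpos: "M > 0" using assms by (simp add: M_def)
  have main: "1 / (2 * M) * (real (card (edges G)) / real n) ^ (2 * k)
      \<le> real (card (copies (linear_cycle r (2 * k)) G))"
    if "r_graph r G" "linear_hypergraph G" and n: "card (verts G) = n"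
      and dense: "real (card (edges G)) \<ge> C * real n powr (1 + 1 / real k)"
    for G :: "'a hypergraph" and n
  proof (cases "n = 0")
    case True
    \<comment> \<open>Division by \<open>n = 0\<close> gives 0, so the claimed lower bound is
      0.\<close>
    then show ?thesis using assms by (simp add: power_0_left)
  next
    case False
    define t where "t = real (card (edges G)) / real n"
    have G: "hypergraph G" and Gcard: "\<And>e. e \<in> edges G \<Longrightarrow> card e = r"
      using that by (auto simp: r_graph_def)
    have finV: "finite (verts G)" and sub: "\<And>e. e \<in> edges G \<Longrightarrow> e \<subseteq> verts G"
      using G by (auto simp: hypergraph_def)
    have finE: "finite (edges G)" using finite_subset[of "edges G" "Pow (verts G)"] finV sub by auto
    \<comment> \<open>Dividing by \<open>n\<close> turns the hypothesis on the number of edges into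
      a bound on \<open>t\<close>.\<close>
    have "real n powr (1 + 1 / real k) = root k n * n"
      using False assms by (simp add: root_powr_inverse powr_add)
    then have t_ge: "C * root k n \<le> t"
      using dense False by (simp add: t_def pos_le_divide_eq mult.assoc)
    moreover have "0 < C * root k n" using Cpos False assms by simp
    ultimately have tpos: "0 < t" by linarith
    have "\<exists>U\<subseteq>verts G. U \<noteq> {} \<and> (\<forall>v\<in>U. t \<le> card {e \<in> edges G. v \<in> e \<and> e \<subseteq> U})"
    proof (rule exists_min_degree_subset[OF finV finE])
      show "e \<subseteq> verts G \<and> e \<noteq> {}" if "e \<in> edges G" for e
        using sub[OF that] Gcard[OF that] assms by auto
      show "verts G \<noteq> {}" using False n by auto
      show "t * card (verts G) \<le> card (edges G)" using False n by (simp add: t_def)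
    qed
    then obtain U where U: "U \<subseteq> verts G" "U \<noteq> {}"
      and deg: "\<forall>v\<in>U. t \<le> card {e \<in> edges G. v \<in> e \<and> e \<subseteq> U}" by blast
    define E where "E = {e \<in> edges G. e \<subseteq> U}"
    interpret linear_system U E r
    proof
      show "finite U" using U finV finite_subset by blast
      show "e = f" if "e \<in> E" "f \<in> E" "x \<in> e" "y \<in> e" "x \<in> f" "y \<in> f" "x \<noteq> y" for e f x y
      proof (rule ccontr)
        assume "e \<noteq> f"
        then have "card (e \<inter> f) \<le> 1"
          using \<open>linear_hypergraph G\<close> that by (auto simp: linear_hypergraph_def E_def)
        moreover have "finite (e \<inter> f)"
          using that sub finV by (auto simp: E_def intro: finite_subset)
        then have "card {x, y} \<le> card (e \<inter> f)" using that by (intro card_mono) auto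
        ultimately show False using \<open>x \<noteq> y\<close> by simp
      qed
    qed (use Gcard assms in \<open>auto simp: E_def\<close>)
    have d: "t \<le> degree v" if "v \<in> U" for v
    proof -
      have "{e \<in> edges G. v \<in> e \<and> e \<subseteq> U} = {e \<in> E. v \<in> e}" by (auto simp: E_def)
      then show ?thesis using bspec[OF deg that] card_edges_le_degree[of v] by simp
    qed
    \<comment> \<open>Pruning only lowers the number of vertices, so the bound on \<open>t\<close>
      survives.\<close>
    have "root k (card U) \<le> root k n"
      using card_mono[OF finV U(1)] n assms by simp
    then have "C * root k (card U) \<le> t"
      using t_ge Cpos mult_left_mono[of "root k (card U)" "root k n" C] by linarith
    then have "t ^ (2 * k) / 2 \<le> card (clean_cycles k)"
      using assms by (intro card_clean_cycles_ge[OF U(2) _ tpos d]) (auto simp: C_def)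
    also have "card (clean_cycles k) \<le> card (copies (linear_cycle r (2 * k)) G) * (2 * k * (r - 1)) ^ (2 * k)"
      by (rule card_clean_cycles_le[OF \<open>k \<ge> 2\<close> G]) (auto simp: E_def)
    finally have "t ^ (2 * k) / 2 \<le> card (copies (linear_cycle r (2 * k)) G) * M"
      by (simp add: M_def)
    then show ?thesis using Mpos by (simp add: t_def[symmetric] field_simps)
  qed
  show ?thesis
    by (rule exI[of _ C], rule exI[of _ "1 / (2 * M)"]) (use Cpos Mpos main in auto)
qed

end
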